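(* Consider the wideband Poisson network with path loss function $l(r)=r^{-\beta}$, $\beta>2$. If the user density is $\lambda_B=\kappa B^{p}$ with $p>\frac{2}{\beta}$ and $\kappa>0$, then for every target rate $\bar R>0$, the IAN decoding condition for the tagged receiver cannot be satisfied almost surely as the bandwidth $B$ grows.
   Context: Wideband Poisson network: a tagged receiver is at a location $y\in\mathbb{R}^2$ and its tagged transmitter is at a fixed non-random distance $r_0$ from it. For bandwidth $B$, the interferers (the other transmitters) are located according to a homogeneous Poisson point process in the plane of intensity $\lambda_B$ (the user density). The wideband limit is the regime $B\to\infty$ in which the average transmit power of each transmitter is fixed at $\bar Q$ Watts and the target data rate of each transmitter is fixed at $\bar R$ bits/s. The received power from the tagged transmitter is $\bar P_0=l(r_0)\bar Q$ Watts, the received power from an interferer at $x$ is $l(|x-y|)\bar Q$ Watts, and $\bar I$ denotes the total received power from all interferers at the tagged receiver. The noise power is $1$ Watt/Hz, so per Hz the target rate is $R=\bar R/B$, the signal power is $P_0=\bar P_0/B$, and the interference power is $I=\bar I/B$. IAN (treating interference as noise) decoding condition: $R<C\!\left(\frac{P_0}{1+I}\right)$, i.e. $\frac{\bar R}{B}<C\!\left(\frac{\bar P_0}{B+\bar I}\right)$, where $C(x)=\log_2(1+x)$. *)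

theory Defs
  imports "HOL-Probability.Probability"
begin

text \<open>A homogeneous Poisson point process is simple, so it is represented as a random locally
  finite set of points. The counts are required to be Poisson distributed with the explicit
  mass function (rather than \<^term>\<open>poisson_pmf\<close>, which is only specified for positive rates)
  so that Lebesgue null sets are covered: there the count is almost surely zero.\<close>

definition poisson_point_process ::
  "'w measure \<Rightarrow> real \<Rightarrow> ('w \<Rightarrow> 'a::euclidean_space set) \<Rightarrow> bool" where
  "poisson_point_process M \<rho> X \<longleftrightarrow>
     (\<forall>\<omega>\<in>space M. \<forall>K. bounded K \<longrightarrow> finite (X \<omega> \<inter> K)) \<and>
     (\<forall>A\<in>sets borel. bounded A \<longrightarrow>
        (\<lambda>\<omega>. card (X \<omega> \<inter> A)) \<in> M \<rightarrow>\<^sub>M count_space UNIV \<and>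
        (\<forall>k. measure M {\<omega>\<in>space M. card (X \<omega> \<inter> A) = k} =
             (\<rho> * measure lborel A) ^ k / fact k * exp (- (\<rho> * measure lborel A)))) \<and>
     (\<forall>A :: nat \<Rightarrow> 'a set.
        (\<forall>i. A i \<in> sets borel \<and> bounded (A i)) \<and> disjoint_family A \<longrightarrow>
        prob_space.indep_vars M (\<lambda>_. count_space UNIV) (\<lambda>i \<omega>. card (X \<omega> \<inter> A i)) UNIV)"

definition power_law_path_loss :: "real \<Rightarrow> real \<Rightarrow> real" where
  "power_law_path_loss \<beta> r = r powr (- \<beta>)"

text \<open>Total power received at \<open>y\<close> from transmitters at the points of \<open>X\<close>, each of power \<open>Q\<close>,
  as a possibly infinite sum of nonnegative terms. With the power law, a point located exactly
  at \<open>y\<close> contributes \<open>0 powr (-\<beta>) = 0\<close>; for a Poisson point process there is almost surely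
  no such point.\<close>

definition total_interference ::
  "(real \<Rightarrow> real) \<Rightarrow> real \<Rightarrow> 'a::euclidean_space \<Rightarrow> 'a set \<Rightarrow> ennreal" where
  "total_interference l Q y X = (\<Sum>\<^sub>\<infinity>x\<in>X. ennreal (l (dist x y) * Q))"

definition capacity :: "real \<Rightarrow> real" where
  "capacity x = log 2 (1 + x)"

text \<open>With noise power 1 per unit of bandwidth, the total noise power is \<open>B\<close>. The quotient is
  formed in the extended nonnegative reals, so infinite interference gives
  signal-to-interference-and-noise ratio zero.\<close>

definition wideband_sinr ::
  "(real \<Rightarrow> real) \<Rightarrow> real \<Rightarrow> real \<Rightarrow> 'a::euclidean_space \<Rightarrow> 'a set \<Rightarrow> real \<Rightarrow> real" where
  "wideband_sinr l Q r0 y X B =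
     enn2real (ennreal (l r0 * Q) / (ennreal B + total_interference l Q y X))"

definition IAN_condition ::
  "(real \<Rightarrow> real) \<Rightarrow> real \<Rightarrow> real \<Rightarrow> 'a::euclidean_space \<Rightarrow> 'a set \<Rightarrow> real \<Rightarrow> real \<Rightarrow> bool" where
  "IAN_condition l Q r0 y X R B \<longleftrightarrow> R / B < capacity (wideband_sinr l Q r0 y X B)"

end

theory Submission
  imports Defs
begin

text \<open>A point within distance \<open>B powr (-1/\<beta>)\<close> of the receiver contributes at least \<open>Q * B\<close> to the
  interference. The expected number of such points is of order \<open>B powr (p - 2/\<beta>)\<close> and hence
  diverges, and the probability that there are fewer than \<open>k\<close> of them decays faster than any power of
  \<open>B\<close>. So the interference exceeds every fixed multiple of \<open>B\<close>, almost surely along arithmetic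
  progressions by Borel--Cantelli, whereas decoding requires it to be below a fixed multiple of
  \<open>B\<close>.\<close>

section \<open>Deterministic bounds on interference and decoding\<close>

lemma total_interference_ge_card:
  fixes X :: "'a::euclidean_space set"
  assumes fin: "finite (X \<inter> A)" and card: "k \<le> card (X \<inter> A)" and "0 \<le> c"
    and c: "\<And>x. x \<in> A \<Longrightarrow> c \<le> l (dist x y) * Q"
  shows "ennreal (real k * c) \<le> total_interference l Q y X"
proof -
  have "real k * c \<le> (\<Sum>x\<in>X \<inter> A. c)"
    using card \<open>0 \<le> c\<close> by (simp add: mult_right_mono)
  also have "\<dots> \<le> (\<Sum>x\<in>X \<inter> A. l (dist x y) * Q)"
    by (intro sum_mono c) auto
  finally have "ennreal (real k * c) \<le> ennreal (\<Sum>x\<in>X \<inter> A. l (dist x y) * Q)"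
    by (rule ennreal_leI)
  also have "\<dots> = (\<Sum>x\<in>X \<inter> A. ennreal (l (dist x y) * Q))"
    by (subst sum_ennreal) (use c \<open>0 \<le> c\<close> in \<open>force intro: order_trans\<close>)+
  also have "\<dots> \<le> total_interference l Q y X"
    unfolding total_interference_def infsum_finite[OF fin, symmetric]
    by (rule infsum_mono_neutral) (auto simp: nonneg_summable_on_complete)
  finally show ?thesis .
qed

text \<open>The radius \<open>B powr (- 1 / \<beta>)\<close> is the one at which the path loss
  equals \<open>B\<close>. Distance 0 is excluded because
  \<open>0 powr (- \<beta>) = 0\<close>.\<close>

lemma power_law_path_loss_ge:
  assumes "0 < B" "0 < \<beta>" "0 < r" "r \<le> B powr (- 1 / \<beta>)"
  shows "B \<le> power_law_path_loss \<beta> r"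
proof -
  have "(B powr (- 1 / \<beta>)) powr (- \<beta>) \<le> r powr (- \<beta>)"
    by (rule powr_mono2') (use assms in auto)
  then show ?thesis
    using assms by (simp add: powr_powr power_law_path_loss_def)
qed

text \<open>By ln(1 + s) \<le> s the capacity is at most linear in the ratio s = P / (B + I), so
  decoding bounds B + I, and with it I, by a multiple of \<open>B\<close> that does not depend on
  the point set.\<close>

lemma IAN_condition_imp_interference_less:
  assumes P: "0 < l r0 * Q" and B: "0 < B" and R: "0 < R"
    and IAN: "IAN_condition l Q r0 y X R B"
  shows "total_interference l Q y X < ennreal (l r0 * Q / (R * ln 2) * B)"
proof (rule ccontr)
  define P where "P = l r0 * Q"
  define K where "K = P / (R * ln 2)"
  have "0 < P" "0 < K"
    using assms by (simp_all add: P_def K_def)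
  assume "\<not> ?thesis"
  then have ge: "ennreal (K * B) \<le> total_interference l Q y X"
    by (simp add: K_def P_def)
  show False
  proof (cases "total_interference l Q y X")
    case top
    \<comment> \<open>Infinite interference makes the ratio, and hence the capacity, zero.\<close>
    with IAN have "R / B < 0"
      by (simp add: IAN_condition_def wideband_sinr_def capacity_def)
    with B R show False
      by (simp add: divide_less_0_iff)
  next
    case (real i)
    define s where "s = P / (B + i)"
    have i: "K * B \<le> i"
      using ge real by simp
    have "0 \<le> s"
      using \<open>0 < P\<close> B real by (simp add: s_def)
    have "wideband_sinr l Q r0 y X B = s"
      using real B \<open>0 < P\<close>
      by (simp add: wideband_sinr_def s_def P_def[symmetric] divide_ennreal flip: ennreal_plus)
    then have "R / B < ln (1 + s) / ln 2"
      using IAN by (simp add: IAN_condition_def capacity_def log_def)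
    also have "\<dots> \<le> s / ln 2"
      using \<open>0 \<le> s\<close> by (intro divide_right_mono ln_add_one_self_le_self) auto
    \<comment> \<open>The noise term is dropped from the denominator: B + i \<ge> i \<ge> K *
      B.\<close>
    also have "s \<le> P / (K * B)"
      unfolding s_def using \<open>0 < P\<close> \<open>0 < K\<close> B i real
    by (intro divide_left_mono mult_pos_pos add_pos_nonneg) auto
    then have "s / ln 2 \<le> P / (K * B) / ln 2"
      by (intro divide_right_mono) auto
    \<comment> \<open>This equation is what dictates the value of \<open>K\<close>.\<close>
    also have "\<dots> = R / B"
      using \<open>0 < P\<close> R B by (simp add: K_def)
    finally show False
      by simp
  qed
qed

section \<open>Poisson counts near the receiver\<close>

lemma poisson_point_process_card_less:
  assumes "prob_space M" "poisson_point_process M \<rho> X" "A \<in> sets borel" "bounded A"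
  shows "{\<omega>\<in>space M. card (X \<omega> \<inter> A) < k} \<in> sets M"
    and "measure M {\<omega>\<in>space M. card (X \<omega> \<inter> A) < k} =
      (\<Sum>j<k. (\<rho> * measure lborel A) ^ j / fact j * exp (- (\<rho> * measure lborel A)))"
proof -
  have [measurable]: "(\<lambda>\<omega>. card (X \<omega> \<inter> A)) \<in> M \<rightarrow>\<^sub>M count_space UNIV"
    and card_eq: "\<And>j. measure M {\<omega>\<in>space M. card (X \<omega> \<inter> A) = j} =
      (\<rho> * measure lborel A) ^ j / fact j * exp (- (\<rho> * measure lborel A))"
    using assms unfolding poisson_point_process_def by blast+
  show "{\<omega>\<in>space M. card (X \<omega> \<inter> A) < k} \<in> sets M"
    by measurable
  have "{\<omega>\<in>space M. card (X \<omega> \<inter> A) < k} = (\<Union>j<k. {\<omega>\<in>space M. card (X \<omega> \<inter> A) = j})"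
    by auto
  then show "measure M {\<omega>\<in>space M. card (X \<omega> \<inter> A) < k} =
      (\<Sum>j<k. (\<rho> * measure lborel A) ^ j / fact j * exp (- (\<rho> * measure lborel A)))"
    using finite_measure.finite_measure_finite_Union[OF prob_space.finite_measure[OF assms(1)],
        of "{..<k}" "\<lambda>j. {\<omega>\<in>space M. card (X \<omega> \<inter> A) = j}"]
    by (simp add: disjoint_family_on_def card_eq image_subset_iff disjoint_iff)
qed

text \<open>The centre is removed so that every counted point has positive distance to the receiver;
  a single point is a null set, so the area stays that of the disc.\<close>

lemma measure_punctured_cball:
  fixes y :: "real ^ 2"
  assumes "0 \<le> r"
  shows "measure lborel (cball y r - {y}) = pi * r\<^sup>2"
proof -
  have "measure lborel (cball y r - {y}) = measure lborel (cball y r)"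
    by (rule measure_Diff_null_set) (auto simp: null_sets_def)
  then show ?thesis
    using assms by (simp add: content_cball unit_ball_vol_2)
qed

lemma power_div_fact_le_exp:
  fixes t :: real
  assumes "0 \<le> t"
  shows "t ^ n / fact n \<le> exp t"
proof -
  have "(\<Sum>k\<in>{n}. t ^ k /\<^sub>R fact k) \<le> (\<Sum>k. t ^ k /\<^sub>R fact k)"
    by (rule sum_le_suminf) (use assms summable_exp[of t] in auto)
  then show ?thesis
    by (simp add: exp_def divide_inverse mult.commute)
qed

text \<open>With t = a * B powr e, one term of the exponential series gives exp(-t) \<le> (j + q)! /
  t^(j + q). The factor t^j cancels and t^(-q) remains, which decays as fast as desired for large q.
  Exponent 2 is enough for summability over integers.\<close>

lemma poisson_mass_bigo:
  fixes a e :: real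
  assumes "a > 0" "e > 0"
  shows "(\<lambda>B. (a * B powr e) ^ j / fact j * exp (- (a * B powr e))) \<in> O(\<lambda>B. B powr (- 2))"
proof -
  \<comment> \<open>This choice gives e * q > 2, so t^(-q) decays at least like
    \<open>B powr (- 2)\<close>.\<close>
  obtain q :: nat where q: "2 / e < real q"
    using reals_Archimedean2 by blast
  define C where "C = fact (j + q) / (fact j * a ^ q)"
  have "(a * B powr e) ^ j / fact j * exp (- (a * B powr e)) \<le> C * B powr (- 2)"
    if "1 \<le> B" for B
  proof -
    define t where "t = a * B powr e"
    have "0 < t"
      using that \<open>a > 0\<close> by (simp add: t_def)
    have "t ^ j * t ^ q \<le> fact (j + q) * exp t"
      using power_div_fact_le_exp[of t "j + q"] \<open>0 < t\<close> by (simp add: power_add field_simps)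
    then have "t ^ j / fact j * exp (- t) \<le> fact (j + q) / (fact j * t ^ q)"
      using \<open>0 < t\<close> by (simp add: exp_minus field_simps)
    also have "\<dots> = C * B powr (- (e * real q))"
      using that by (simp add: C_def t_def power_mult_distrib powr_powr powr_minus field_simps
          flip: powr_realpow)
    also have "\<dots> \<le> C * B powr (- 2)"
      using that q assms by (intro mult_left_mono powr_mono) (auto simp: C_def field_simps)
    finally show ?thesis
      by (simp add: t_def)
  qed
  then show ?thesis
    using \<open>a > 0\<close> by (intro bigoI[of _ C] eventually_mono[OF eventually_ge_at_top[of 1]]) auto
qed

lemma few_near_points_bigo:
  fixes \<Phi> :: "real \<Rightarrow> 'w \<Rightarrow> (real ^ 2) set"
  assumes "prob_space M" "0 < \<beta>" "2 / \<beta> < p" "0 < \<kappa>"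
    and PPP: "\<And>B. B > 0 \<Longrightarrow> poisson_point_process M (\<kappa> * B powr p) (\<Phi> B)"
  shows "(\<lambda>B. measure M {\<omega>\<in>space M. card (\<Phi> B \<omega> \<inter> (cball y (B powr (- 1 / \<beta>)) - {y})) < k})
    \<in> O(\<lambda>B. B powr (- 2))"
proof -
  \<comment> \<open>Intensity times disc area is \<open>a * B powr e\<close>, the mean number of
    near points; p > 2/\<beta> makes it diverge.\<close>
  define a e where "a = \<kappa> * pi" and "e = p - 2 / \<beta>"
  have "a > 0" "e > 0"
    using assms by (simp_all add: a_def e_def)
  then have "(\<lambda>B. \<Sum>j<k. (a * B powr e) ^ j / fact j * exp (- (a * B powr e)))
      \<in> O(\<lambda>B. B powr (- 2))"
    by (intro big_sum_in_bigo poisson_mass_bigo)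
  moreover have "\<forall>\<^sub>F B in at_top.
      measure M {\<omega>\<in>space M. card (\<Phi> B \<omega> \<inter> (cball y (B powr (- 1 / \<beta>)) - {y})) < k} =
      (\<Sum>j<k. (a * B powr e) ^ j / fact j * exp (- (a * B powr e)))"
    using eventually_gt_at_top[of 0]
  proof eventually_elim
    case (elim B)
    have "(B powr (- 1 / \<beta>))\<^sup>2 = B powr (- (2 / \<beta>))"
      using elim by (simp add: power2_eq_square flip: powr_add)
    then have "\<kappa> * B powr p * measure lborel (cball y (B powr (- 1 / \<beta>)) - {y}) = a * B powr e"
      by (simp add: measure_punctured_cball a_def e_def powr_diff powr_minus field_simps)
    then show ?case
      by (subst poisson_point_process_card_less(2)[OF assms(1) PPP[OF elim]])
        (auto intro: bounded_subset[OF bounded_cball])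
  qed
  ultimately show ?thesis
    by (simp add: landau_o.big.in_cong)
qed

text \<open>All randomness is packed into the events \<open>E B\<close> of having too few near
  points; off them the interference bound is deterministic.\<close>

lemma interference_ge_outside_small_events:
  fixes \<Phi> :: "real \<Rightarrow> 'w \<Rightarrow> (real ^ 2) set"
  assumes "prob_space M" "0 < Q" "0 < \<beta>" "2 / \<beta> < p" "0 < \<kappa>"
    and PPP: "\<And>B. B > 0 \<Longrightarrow> poisson_point_process M (\<kappa> * B powr p) (\<Phi> B)"
  obtains E where "\<And>B. B > 0 \<Longrightarrow> E B \<in> sets M"
    and "(\<lambda>B. measure M (E B)) \<in> O(\<lambda>B. B powr (- 2))"
    and "\<And>B \<omega>. \<lbrakk>B > 0; \<omega> \<in> space M - E B\<rbrakk> \<Longrightarrow>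
      ennreal (K * B) \<le> total_interference (power_law_path_loss \<beta>) Q y (\<Phi> B \<omega>)"
proof
  \<comment> \<open>Each near point contributes at least \<open>B * Q\<close>, so K / Q of them
    reach \<open>K * B\<close>; this number is independent of \<open>B\<close>.\<close>
  define k where "k = nat \<lceil>K / Q\<rceil>"
  define A where "A B = cball y (B powr (- 1 / \<beta>)) - {y}" for B
  define E where "E B = {\<omega>\<in>space M. card (\<Phi> B \<omega> \<inter> A B) < k}" for B
  have A: "A B \<in> sets borel" "bounded (A B)" for B
    by (auto simp: A_def intro: bounded_subset[OF bounded_cball])
  show "E B \<in> sets M" if "B > 0" for B
    unfolding E_def by (rule poisson_point_process_card_less(1)[OF assms(1) PPP[OF that] A])
  show "(\<lambda>B. measure M (E B)) \<in> O(\<lambda>B. B powr (- 2))"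
    unfolding E_def A_def by (rule few_near_points_bigo[OF assms(1,3-5) PPP])
  show "ennreal (K * B) \<le> total_interference (power_law_path_loss \<beta>) Q y (\<Phi> B \<omega>)"
    if "B > 0" and \<omega>: "\<omega> \<in> space M - E B" for B \<omega>
  proof -
    have "K / Q \<le> real k"
      unfolding k_def by linarith
    then have "K * B \<le> real k * (B * Q)"
      using \<open>Q > 0\<close> \<open>B > 0\<close> by (simp add: field_simps)
    then have "ennreal (K * B) \<le> ennreal (real k * (B * Q))"
      by (rule ennreal_leI)
    also have "\<dots> \<le> total_interference (power_law_path_loss \<beta>) Q y (\<Phi> B \<omega>)"
    proof (rule total_interference_ge_card)
      have "\<forall>\<omega>\<in>space M. \<forall>C. bounded C \<longrightarrow> finite (\<Phi> B \<omega> \<inter> C)"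
        using PPP[OF \<open>B > 0\<close>] unfolding poisson_point_process_def by (rule conjunct1)
      then show "finite (\<Phi> B \<omega> \<inter> A B)"
        using \<omega> A(2) by blast
      show "k \<le> card (\<Phi> B \<omega> \<inter> A B)"
        using \<omega> by (auto simp: E_def)
      show "B * Q \<le> power_law_path_loss \<beta> (dist x y) * Q" if "x \<in> A B" for x
        using that \<open>B > 0\<close> \<open>\<beta> > 0\<close> \<open>Q > 0\<close> power_law_path_loss_ge[of B \<beta> "dist x y"]
        by (auto simp: A_def dist_commute)
    qed (use \<open>B > 0\<close> \<open>Q > 0\<close> in simp)
    finally show ?thesis .
  qed
qed

section \<open>Borel-Cantelli and almost sure failure of decoding\<close>

lemma AE_eventually_not_in_of_bigo:
  fixes E :: "real \<Rightarrow> 'w set"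
  assumes finite: "finite_measure M"
    and meas: "\<And>B. B > 0 \<Longrightarrow> E B \<in> sets M"
    and small: "(\<lambda>B. measure M (E B)) \<in> O(\<lambda>B. B powr (- 2))"
    and "\<delta> > 0"
  shows "AE \<omega> in M. \<forall>\<^sub>F n in sequentially. \<omega> \<notin> E (real n * \<delta>)"
proof -
  have lim: "filterlim (\<lambda>n. real n * \<delta>) at_top sequentially"
    by (rule filterlim_at_top_mult_tendsto_pos[OF tendsto_const \<open>\<delta> > 0\<close> filterlim_real_sequentially])
  have "(\<lambda>n. measure M (E (real n * \<delta>))) \<in> O(\<lambda>n. (real n * \<delta>) powr (- 2))"
    using landau_o.big.compose[OF small lim] .
  also have "(\<lambda>n. (real n * \<delta>) powr (- 2)) \<in> O(\<lambda>n. real n powr (- 2))"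
    using \<open>\<delta> > 0\<close> by (simp add: powr_mult)
  finally have "summable (\<lambda>n. measure M (E (real n * \<delta>)))"
    by (rule summable_comparison_test_bigo[rotated]) (simp add: summable_real_powr_iff)
  \<comment> \<open>The index is shifted because \<open>E 0\<close> need not be measurable.\<close>
  then have "summable (\<lambda>n. measure M (E (real (Suc n) * \<delta>)))"
    by (subst summable_Suc_iff)
  then have "AE \<omega> in M. \<forall>\<^sub>F n in sequentially. \<omega> \<in> space M - E (real (Suc n) * \<delta>)"
    by (intro borel_cantelli_AE1 meas) (use \<open>\<delta> > 0\<close> in \<open>auto simp: finite_measure.emeasure_eq_measure[OF finite]\<close>)
  then show ?thesis
  proof eventually_elim
    case (elim \<omega>)
    then have "\<forall>\<^sub>F n in sequentially. \<omega> \<notin> E (real (Suc n) * \<delta>)"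
      by eventually_elim auto
    then show ?case
      by (subst (asm) eventually_sequentially_Suc)
  qed
qed

text \<open>The law of each \<open>\<Phi> B\<close> is fixed, but not the coupling between
  bandwidths, and Borel-Cantelli controls only countably many of them. Hence three claims: vanishing
  probability, almost sure failure along every arithmetic progression, and almost sure failure at
  all large real \<open>B\<close> when the interference is monotone in \<open>B\<close>, as when
  users are only added.\<close>

theorem theorem4:
  fixes M :: "'w measure"
    and \<Phi> :: "real \<Rightarrow> 'w \<Rightarrow> (real ^ 2) set"
    and y :: "real ^ 2"
    and r0 Q \<beta> \<kappa> p R :: real
    and l :: "real \<Rightarrow> real"
  assumes "prob_space M"
    and "r0 > 0" and "Q > 0"
    and "\<beta> > 2" and "l = power_law_path_loss \<beta>"
    and "p > 2 / \<beta>" and "\<kappa> > 0"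
    and "\<And>B. B > 0 \<Longrightarrow> poisson_point_process M (\<kappa> * B powr p) (\<Phi> B)"
    and "R > 0"
  shows "((\<lambda>B. measure M {\<omega>\<in>space M. IAN_condition l Q r0 y (\<Phi> B \<omega>) R B}) \<longlongrightarrow> 0) at_top
    \<and> (\<forall>\<delta>>0. AE \<omega> in M. \<forall>\<^sub>F n in sequentially.
         \<not> IAN_condition l Q r0 y (\<Phi> (real n * \<delta>) \<omega>) R (real n * \<delta>))
    \<and> ((AE \<omega> in M. mono_on {0<..} (\<lambda>B. total_interference l Q y (\<Phi> B \<omega>))) \<longrightarrow>
         (AE \<omega> in M. \<forall>\<^sub>F B in at_top. \<not> IAN_condition l Q r0 y (\<Phi> B \<omega>) R B))"
proof -
  have finite: "finite_measure M"
    using assms(1) by (rule prob_space.finite_measure)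
  define P where "P = l r0 * Q"
  have P: "0 < P"
    using assms by (simp add: P_def power_law_path_loss_def)
  define K where "K = P / (R * ln 2)"
  have K: "0 < K"
    using P \<open>R > 0\<close> by (simp add: K_def)
  have "0 < \<beta>"
    using \<open>\<beta> > 2\<close> by simp
  \<comment> \<open>The factor 2 absorbs rounding the bandwidth down to an integer in the monotone case.\<close>
  obtain E where E_sets: "\<And>B. B > 0 \<Longrightarrow> E B \<in> sets M"
    and E_bigo: "(\<lambda>B. measure M (E B)) \<in> O(\<lambda>B. B powr (- 2))"
    and ge: "\<And>B \<omega>. \<lbrakk>B > 0; \<omega> \<in> space M - E B\<rbrakk> \<Longrightarrow>
      ennreal (2 * K * B) \<le> total_interference l Q y (\<Phi> B \<omega>)"
    using interference_ge_outside_small_events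
      [OF assms(1,3) \<open>0 < \<beta>\<close> assms(6-8), where K = "2 * K" and y = y, folded assms(5)]
    by blast
  have not_IAN: "\<not> IAN_condition l Q r0 y X R B"
    if "B > 0" "ennreal (K * B) \<le> total_interference l Q y X" for B X
    using IAN_condition_imp_interference_less[of l r0 Q B R y X] that P \<open>R > 0\<close>
    by (auto simp: K_def P_def not_less)
  have not_IAN': "\<not> IAN_condition l Q r0 y (\<Phi> B \<omega>) R B"
    if "B > 0" "\<omega> \<in> space M - E B" for B \<omega>
  proof -
    have "ennreal (K * B) \<le> ennreal (2 * K * B)"
      using K that by (intro ennreal_leI) simp
    with ge[OF that] that not_IAN show ?thesis
      by (meson order_trans)
  qed
  \<comment> \<open>Inclusion in the measurable set \<open>E B\<close> suffices, since
    \<open>measure\<close> is 0 on nonmeasurable sets.\<close>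
  have prob_le: "measure M {\<omega>\<in>space M. IAN_condition l Q r0 y (\<Phi> B \<omega>) R B} \<le> measure M (E B)"
    if "B > 0" for B
    using not_IAN' that E_sets
    by (intro finite_measure.finite_measure_mono[OF finite]) auto
  have "(\<lambda>B::real. B powr (- 2)) \<in> o(\<lambda>_. 1)"
    by (intro smalloI_tendsto) (simp_all add: tendsto_neg_powr filterlim_ident)
  with E_bigo have "(\<lambda>B. measure M (E B)) \<in> o(\<lambda>_. 1)"
    by (rule landau_o.big_small_trans)
  then have "((\<lambda>B. measure M (E B)) \<longlongrightarrow> 0) at_top"
    by (auto dest: smalloD_tendsto)
  then have 1: "((\<lambda>B. measure M {\<omega>\<in>space M. IAN_condition l Q r0 y (\<Phi> B \<omega>) R B}) \<longlongrightarrow> 0) at_top"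
    by (rule tendsto_sandwich[rotated 3, where f = "\<lambda>_. 0"])
      (auto intro: eventually_mono[OF eventually_gt_at_top[of 0]] prob_le)
  have AE_E: "AE \<omega> in M. \<forall>\<^sub>F n in sequentially. \<omega> \<notin> E (real n * \<delta>)" if "\<delta> > 0" for \<delta>
    using AE_eventually_not_in_of_bigo[OF finite E_sets E_bigo that] .
  have 2: "AE \<omega> in M. \<forall>\<^sub>F n in sequentially.
      \<not> IAN_condition l Q r0 y (\<Phi> (real n * \<delta>) \<omega>) R (real n * \<delta>)" if "\<delta> > 0" for \<delta>
    using AE_E[OF that] AE_space
  proof eventually_elim
    case (elim \<omega>)
    show ?case
      using elim(1) eventually_gt_at_top[of 0]
      by eventually_elim (use elim that not_IAN' in auto)
  qed
  have 3: "AE \<omega> in M. \<forall>\<^sub>F B in at_top. \<not> IAN_condition l Q r0 y (\<Phi> B \<omega>) R B"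
    if mono: "AE \<omega> in M. mono_on {0<..} (\<lambda>B. total_interference l Q y (\<Phi> B \<omega>))"
    using AE_E[OF zero_less_one] mono AE_space
  proof eventually_elim
    case (elim \<omega>)
    \<comment> \<open>The statement along the integers is transferred to real bandwidths through the
      floor, which tends to infinity with \<open>B\<close>.\<close>
    have "\<forall>\<^sub>F B in at_top. \<omega> \<notin> E (real (nat \<lfloor>B\<rfloor>) * 1)"
      using elim(1) by (rule eventually_compose_filterlim[OF _
        filterlim_compose[OF filterlim_nat_sequentially filterlim_floor_sequentially]])
    then show ?case
      using eventually_ge_at_top[of 1]
    proof eventually_elim
      case B: (elim B)
      define m where "m = real (nat \<lfloor>B\<rfloor>)"
      have "1 \<le> m" "m \<le> B" "B < m + 1"
        using B(2) by (simp_all add: m_def)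
      then have m: "1 \<le> m" "m \<le> B" "B \<le> 2 * m"
        by auto
      have "K * B \<le> K * (2 * m)"
        using m K by (intro mult_left_mono) auto
      then have "ennreal (K * B) \<le> ennreal (2 * K * m)"
        by (intro ennreal_leI) (simp add: mult_ac)
      also have "\<dots> \<le> total_interference l Q y (\<Phi> m \<omega>)"
        using m B(1) elim(3) by (intro ge) (simp_all add: m_def)
      \<comment> \<open>Monotonicity carries the bound from the integer \<open>m\<close> up to
        \<open>B\<close>; it is still at least \<open>K * B\<close> because B \<le> 2 * m.\<close>
      also have "\<dots> \<le> total_interference l Q y (\<Phi> B \<omega>)"
        using m by (intro mono_onD[OF elim(2)]) auto
      finally show ?case
        using m by (intro not_IAN) auto
    qed
  qed
  show ?thesis
    by (intro conjI allI impI 1 2 3)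
qed

end
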